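(* Let $\mathcal{H}$ be a complex Hilbert space, let $\{P_n\}_{n\in\mathbb{Z}}$ and $\{Q_n\}_{n\in\mathbb{Z}}$ be two block decompositions of $\mathcal{H}$, let $M\ge 0$ be an integer, and let $T\in\mathcal{B}(\mathcal{H})$ be an asymmetric block band operator of bandwidth $M$ relative to $\{P_n\}_{n\in\mathbb{Z}},\{Q_n\}_{n\in\mathbb{Z}}$; that is, $Q_iTP_j=0$ for all $i,j\in\mathbb{Z}$ with $|i-j|>M$. For $-M\le k\le M$ let $$T_k:=\sum_{n\in\mathbb{Z}}Q_nTP_{n+k}$$ (convergence in the strong operator topology), so that $\{T_k\}_{k=-M}^{M}$ is the asymmetric shift decomposition of $T$. Then the following equality of ideals of $\mathcal{B}(\mathcal{H})$ holds: $$\langle T\rangle=\sum_{k=-M}^{M}\langle T_k\rangle .$$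
   Context: $\mathcal{B}(\mathcal{H})$ denotes the algebra of bounded linear operators on $\mathcal{H}$. "Projection" means orthogonal projection. A block decomposition is a sequence $\{P_n\}_{n\in\mathbb{Z}}$ of mutually orthogonal projections in $\mathcal{B}(\mathcal{H})$ (some of which may be zero) with $\sum_{n\in\mathbb{Z}}P_n=I$ (in the strong operator topology). The two block decompositions $\{P_n\}$ and $\{Q_n\}$ need not be related to each other. For any two sequences of mutually orthogonal projections and any $T\in\mathcal{B}(\mathcal{H})$, the series $\sum_{n\in\mathbb{Z}}Q_nTP_{n+k}$ converges in the strong operator topology to a bounded operator. An ideal means a two-sided ideal of the algebra $\mathcal{B}(\mathcal{H})$ (not necessarily norm closed). For $X\in\mathcal{B}(\mathcal{H})$, $\langle X\rangle$ denotes the principal ideal generated by $X$, i.e. the smallest two-sided ideal of $\mathcal{B}(\mathcal{H})$ containing $X$. The sum of finitely many ideals $\mathcal{I}_k$ is the ideal $\{\sum_k A_k : A_k\in\mathcal{I}_k\}$. *)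

theory Defs
  imports "HOL-Analysis.Analysis" "HOL-Algebra.Ideal"
begin

text \<open>The inner product is linear in the second and conjugate-linear in the first argument.\<close>

class complex_inner = real_normed_vector +
  fixes scaleC :: "complex \<Rightarrow> 'a \<Rightarrow> 'a"  (infixr \<open>*\<^sub>C\<close> 75)
    and cinner :: "'a \<Rightarrow> 'a \<Rightarrow> complex"
  assumes scaleC_add_right: "c *\<^sub>C (x + y) = c *\<^sub>C x + c *\<^sub>C y"
    and scaleC_add_left: "(c + d) *\<^sub>C x = c *\<^sub>C x + d *\<^sub>C x"
    and scaleC_scaleC: "c *\<^sub>C d *\<^sub>C x = (c * d) *\<^sub>C x"
    and scaleC_of_real: "complex_of_real r *\<^sub>C x = r *\<^sub>R x"
    and cinner_commute: "cinner x y = cnj (cinner y x)"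
    and cinner_add_right: "cinner x (y + z) = cinner x y + cinner x z"
    and cinner_scaleC_right: "cinner x (c *\<^sub>C y) = c * cinner x y"
    and cinner_self: "cinner x x = complex_of_real ((norm x)\<^sup>2)"

class chilbert_space = complex_inner + complete_space

instantiation complex :: chilbert_space
begin

definition scaleC_complex :: "complex \<Rightarrow> complex \<Rightarrow> complex"
  where "scaleC_complex c x = c * x"

definition cinner_complex :: "complex \<Rightarrow> complex \<Rightarrow> complex"
  where "cinner_complex x y = cnj x * y"

instance
proof
  fix r :: real and c d x y z :: complex
  show "c *\<^sub>C (x + y) = c *\<^sub>C x + c *\<^sub>C y" "(c + d) *\<^sub>C x = c *\<^sub>C x + d *\<^sub>C x"
    by (simp_all only: scaleC_complex_def distrib_left distrib_right)
  show "c *\<^sub>C d *\<^sub>C x = (c * d) *\<^sub>C x" "complex_of_real r *\<^sub>C x = r *\<^sub>R x"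
    by (simp_all only: scaleC_complex_def mult.assoc scaleR_conv_of_real)
  show "cinner x y = cnj (cinner y x)" "cinner x (y + z) = cinner x y + cinner x z"
    by (simp_all add: cinner_complex_def distrib_left)
  show "cinner x (c *\<^sub>C y) = c * cinner x y"
    by (simp only: scaleC_complex_def cinner_complex_def mult.left_commute)
  show "cinner x x = complex_of_real ((norm x)\<^sup>2)"
    by (simp only: cinner_complex_def complex_norm_square mult.commute)
qed

end

definition bounded_clinear :: "('a::complex_inner \<Rightarrow> 'a) \<Rightarrow> bool"
  where "bounded_clinear T \<longleftrightarrow> bounded_linear T \<and> (\<forall>c x. T (c *\<^sub>C x) = c *\<^sub>C T x)"

lemma scaleC_zero_right: "c *\<^sub>C (0::'a::complex_inner) = 0"
  using scaleC_add_right[of c 0 "0::'a"] by simp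

lemma scaleC_minus_right: "c *\<^sub>C (- x) = - (c *\<^sub>C (x::'a::complex_inner))"
  using scaleC_add_right[of c x "- x"] by (simp add: scaleC_zero_right minus_unique)

lemma bounded_clinear_zero: "bounded_clinear (\<lambda>x. 0)"
  by (simp add: bounded_clinear_def scaleC_zero_right)

lemma bounded_clinear_id: "bounded_clinear id"
  by (simp add: bounded_clinear_def id_def)

lemma bounded_clinear_minus: "bounded_clinear S \<Longrightarrow> bounded_clinear (\<lambda>x. - S x)"
  by (simp add: bounded_clinear_def scaleC_minus_right bounded_linear_minus)

lemma bounded_clinear_add:
  "bounded_clinear S \<Longrightarrow> bounded_clinear T \<Longrightarrow> bounded_clinear (\<lambda>x. S x + T x)"
  by (simp add: bounded_clinear_def scaleC_add_right bounded_linear_add)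

lemma bounded_clinear_comp:
  "bounded_clinear S \<Longrightarrow> bounded_clinear T \<Longrightarrow> bounded_clinear (S \<circ> T)"
  by (simp add: bounded_clinear_def o_def bounded_linear_compose)

text \<open>The operators form a unital complex algebra, so the ideals of this ring are
  closed under complex scalars and are exactly the two-sided ideals of the algebra.\<close>

definition bounded_ops :: "('a::complex_inner \<Rightarrow> 'a) ring"  (\<open>\<B>\<close>)
  where "\<B> = \<lparr>carrier = {T. bounded_clinear T}, mult = (\<circ>), one = id,
               zero = (\<lambda>x. 0), add = (\<lambda>S T x. S x + T x)\<rparr>"

lemma ring_bounded_ops: "ring (\<B> :: ('a::complex_inner \<Rightarrow> 'a) ring)"
proof (rule ringI)
  show "abelian_group (\<B> :: ('a \<Rightarrow> 'a) ring)"
  proof (rule abelian_groupI)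
    fix S :: "'a \<Rightarrow> 'a" assume "S \<in> carrier \<B>"
    then show "\<exists>R\<in>carrier \<B>. R \<oplus>\<^bsub>\<B>\<^esub> S = \<zero>\<^bsub>\<B>\<^esub>"
      by (intro bexI[of _ "\<lambda>x. - S x"]) (simp_all add: bounded_ops_def bounded_clinear_minus)
  qed (simp_all add: bounded_ops_def bounded_clinear_zero bounded_clinear_add ac_simps)
  show "monoid (\<B> :: ('a \<Rightarrow> 'a) ring)"
    by (rule monoidI)
      (simp_all add: bounded_ops_def bounded_clinear_id bounded_clinear_comp o_assoc)
next
  fix R S T :: "'a \<Rightarrow> 'a"
  assume T: "T \<in> carrier \<B>"
  show "(R \<oplus>\<^bsub>\<B>\<^esub> S) \<otimes>\<^bsub>\<B>\<^esub> T = R \<otimes>\<^bsub>\<B>\<^esub> T \<oplus>\<^bsub>\<B>\<^esub> S \<otimes>\<^bsub>\<B>\<^esub> T"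
    by (simp add: bounded_ops_def o_def)
  have "T (x + y) = T x + T y" for x y
    using T by (simp add: bounded_ops_def bounded_clinear_def linear_simps)
  then show "T \<otimes>\<^bsub>\<B>\<^esub> (R \<oplus>\<^bsub>\<B>\<^esub> S) = T \<otimes>\<^bsub>\<B>\<^esub> R \<oplus>\<^bsub>\<B>\<^esub> T \<otimes>\<^bsub>\<B>\<^esub> S"
    by (simp add: bounded_ops_def o_def)
qed

definition projection :: "('a::complex_inner \<Rightarrow> 'a) \<Rightarrow> bool"
  where "projection P \<longleftrightarrow>
    bounded_clinear P \<and> P \<circ> P = P \<and> (\<forall>x y. cinner (P x) y = cinner x (P y))"

definition has_sot_sum :: "('i \<Rightarrow> 'a \<Rightarrow> 'a) \<Rightarrow> ('a::complex_inner \<Rightarrow> 'a) \<Rightarrow> bool"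
  where "has_sot_sum F S \<longleftrightarrow> (\<forall>x. ((\<lambda>i. F i x) has_sum S x) UNIV)"

text \<open>At a point where the family is not summable, the value is 0 by the convention of
  \<^const>\<open>infsum\<close>; the block series in \<open>shift_component\<close> below are summable everywhere.\<close>

definition sot_sum :: "('i \<Rightarrow> 'a \<Rightarrow> 'a) \<Rightarrow> 'a::complex_inner \<Rightarrow> 'a"
  where "sot_sum F = (\<lambda>x. \<Sum>\<^sub>\<infinity>i. F i x)"

lemma has_sot_sum_imp_sot_sum: "has_sot_sum F S \<Longrightarrow> sot_sum F = S"
  by (auto simp: has_sot_sum_def sot_sum_def infsumI)

definition block_decomposition :: "(int \<Rightarrow> 'a::complex_inner \<Rightarrow> 'a) \<Rightarrow> bool"
  where "block_decomposition P \<longleftrightarrow>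
    (\<forall>n. projection (P n)) \<and>
    (\<forall>m n. m \<noteq> n \<longrightarrow> P m \<circ> P n = (\<lambda>x. 0)) \<and>
    has_sot_sum P id"

definition block_band ::
  "nat \<Rightarrow> (int \<Rightarrow> 'a \<Rightarrow> 'a) \<Rightarrow> (int \<Rightarrow> 'a \<Rightarrow> 'a) \<Rightarrow> ('a::complex_inner \<Rightarrow> 'a) \<Rightarrow> bool"
  where "block_band M P Q T \<longleftrightarrow>
    (\<forall>i j. \<bar>i - j\<bar> > int M \<longrightarrow> Q i \<circ> T \<circ> P j = (\<lambda>x. 0))"

definition shift_component ::
  "(int \<Rightarrow> 'a \<Rightarrow> 'a) \<Rightarrow> (int \<Rightarrow> 'a \<Rightarrow> 'a) \<Rightarrow> ('a::complex_inner \<Rightarrow> 'a) \<Rightarrow> int \<Rightarrow> 'a \<Rightarrow> 'a"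
  where "shift_component P Q T k = sot_sum (\<lambda>n. Q n \<circ> T \<circ> P (n + k))"

definition ideal_sum :: "('r, 'm) ring_scheme \<Rightarrow> 'k set \<Rightarrow> ('k \<Rightarrow> 'r set) \<Rightarrow> 'r set"
  where "ideal_sum R K I = {finsum R A K | A. \<forall>k\<in>K. A k \<in> I k}"

end

theory Submission
  imports Defs
begin

text \<open>Only the inclusion of each \<open>T\<^sub>k\<close> in \<open>\<langle>T\<rangle>\<close> needs an idea. Put \<open>N = 2M + 1\<close> and let \<open>E\<^sub>s\<close> and
  \<open>F\<^sub>r\<close> be the sums of the \<open>P\<^sub>m\<close> with \<open>m \<equiv> s\<close> and of the \<open>Q\<^sub>n\<close> with \<open>n \<equiv> r\<close> modulo \<open>N\<close>. In
  \<open>F\<^sub>r T E\<^bsub>r+k\<^esub>\<close> only the blocks \<open>Q\<^sub>n T P\<^sub>m\<close> with \<open>m - n \<equiv> k\<close> occur, and among these the band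
  condition leaves only \<open>m = n + k\<close>, since \<open>|m - n|\<close> and \<open>|k|\<close> are both at most \<open>M\<close>. Hence
  \<open>T\<^sub>k\<close> is the finite sum of the \<open>F\<^sub>r T E\<^bsub>r+k\<^esub>\<close> over the residues \<open>r\<close>.\<close>

section \<open>Sums of ideals\<close>

lemma ideal_sumI: "(\<And>k. k \<in> K \<Longrightarrow> A k \<in> I k) \<Longrightarrow> finsum R A K \<in> ideal_sum R K I"
  by (auto simp: ideal_sum_def)

context ring
begin

lemma ideal_finsum_closed:
  assumes "ideal I R" and "finite K" and "\<And>k. k \<in> K \<Longrightarrow> A k \<in> I"
  shows "finsum R A K \<in> I"
proof -
  interpret I: ideal I R by fact
  show ?thesis
    using assms(2,3)
  proof (induction K rule: finite_induct)
    case (insert k K)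
    then have "A \<in> K \<rightarrow> carrier R" "A k \<in> carrier R"
      by (auto intro: I.Icarr)
    with insert show ?case
      by (simp add: finsum_insert)
  qed simp
qed

lemma ideal_ideal_sum:
  assumes K: "finite K" and I: "\<And>k. k \<in> K \<Longrightarrow> ideal (I k) R"
  shows "ideal (ideal_sum R K I) R"
proof (rule idealI)
  have carr: "A \<in> K \<rightarrow> carrier R" if "\<forall>k\<in>K. A k \<in> I k" for A
    using that I by (auto intro: ideal.Icarr)
  \<comment> \<open>Left multiplication comes first because the negatives below are obtained as
    products with \<open>\<ominus> \<one>\<close>.\<close>
  have l: "x \<otimes> a \<in> ideal_sum R K I" if "a \<in> ideal_sum R K I" "x \<in> carrier R" for a x
  proof -
    from that(1) obtain A where A: "\<forall>k\<in>K. A k \<in> I k" "a = finsum R A K"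
      by (auto simp: ideal_sum_def)
    have "x \<otimes> a = finsum R (\<lambda>k. x \<otimes> A k) K"
      unfolding A(2) by (rule finsum_rdistr[OF K that(2) carr[OF A(1)]])
    then show ?thesis
      using A(1) I that(2) by (auto intro!: ideal_sumI intro: ideal.I_l_closed)
  qed
  then show "x \<otimes> a \<in> ideal_sum R K I" if "a \<in> ideal_sum R K I" "x \<in> carrier R" for a x
    using that by blast
  show "a \<otimes> x \<in> ideal_sum R K I" if "a \<in> ideal_sum R K I" "x \<in> carrier R" for a x
  proof -
    from that(1) obtain A where A: "\<forall>k\<in>K. A k \<in> I k" "a = finsum R A K"
      by (auto simp: ideal_sum_def)
    have "a \<otimes> x = finsum R (\<lambda>k. A k \<otimes> x) K"
      unfolding A(2) by (rule finsum_ldistr[OF K that(2) carr[OF A(1)]])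
    then show ?thesis
      using A(1) I that(2) by (auto intro!: ideal_sumI intro: ideal.I_r_closed)
  qed
  have sub: "ideal_sum R K I \<subseteq> carrier R"
    using carr by (auto simp: ideal_sum_def intro: finsum_closed)
  show "subgroup (ideal_sum R K I) (add_monoid R)"
  proof (rule add.subgroupI)
    show "ideal_sum R K I \<subseteq> carrier R"
      by (fact sub)
    have "finsum R (\<lambda>k. \<zero>) K \<in> ideal_sum R K I"
      using I by (intro ideal_sumI) (rule additive_subgroup.zero_closed[OF ideal.axioms(1)])
    then show "ideal_sum R K I \<noteq> {}" by blast
    show "\<ominus> a \<in> ideal_sum R K I" if "a \<in> ideal_sum R K I" for a
      using l[OF that, of "\<ominus> \<one>"] sub that by (simp add: l_minus subset_iff)
    show "a \<oplus> b \<in> ideal_sum R K I"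
      if "a \<in> ideal_sum R K I" "b \<in> ideal_sum R K I" for a b
    proof -
      from that obtain A B where A: "\<forall>k\<in>K. A k \<in> I k" "a = finsum R A K"
        and B: "\<forall>k\<in>K. B k \<in> I k" "b = finsum R B K"
        by (auto simp: ideal_sum_def)
      have "a \<oplus> b = finsum R (\<lambda>k. A k \<oplus> B k) K"
        using carr[OF A(1)] carr[OF B(1)] A(2) B(2) by (simp add: finsum_addf)
      then show ?thesis
        using A(1) B(1) I
        by (auto intro!: ideal_sumI intro: additive_subgroup.a_closed[OF ideal.axioms(1)])
    qed
  qed
qed (fact ring_axioms)

end

section \<open>Sums of operators\<close>

text \<open>Turns identities between ring sums of operators into identities of vectors, where strong
  convergence can be expressed by \<open>has_sum\<close>.\<close>

lemma finsum_bounded_ops_apply: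
  fixes A :: "'k \<Rightarrow> 'a::complex_inner \<Rightarrow> 'a"
  assumes "finite K" and "\<And>k. k \<in> K \<Longrightarrow> A k \<in> carrier \<B>"
  shows "finsum \<B> A K x = (\<Sum>k\<in>K. A k x)"
  using assms
proof (induction K rule: finite_induct)
  interpret ring "\<B> :: ('a \<Rightarrow> 'a) ring" by (rule ring_bounded_ops)
  {
    case empty
    show ?case by simp (simp add: bounded_ops_def)
  next
    case (insert k K)
    then have "finsum \<B> A (insert k K) = A k \<oplus>\<^bsub>\<B>\<^esub> finsum \<B> A K"
      by (intro finsum_insert) auto
    with insert show ?case
      by (simp add: bounded_ops_def)
  }
qed

lemma has_sum_sum_functions:
  fixes f :: "'k \<Rightarrow> 'i \<Rightarrow> 'b::topological_comm_monoid_add"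
  assumes "\<And>k. k \<in> K \<Longrightarrow> (f k has_sum s k) A"
  shows "((\<lambda>i. \<Sum>k\<in>K. f k i) has_sum (\<Sum>k\<in>K. s k)) A"
  using assms by (induction K rule: infinite_finite_induct) (auto intro: has_sum_add)

section \<open>Complex scalars, the inner product and orthogonality\<close>

lemma norm_scaleC: "norm (c *\<^sub>C x) = cmod c * norm (x::'a::complex_inner)"
proof -
  have "cinner (c *\<^sub>C x) (c *\<^sub>C x) = cnj (c * cinner x x) * c"
    by (metis cinner_scaleC_right cinner_commute mult.commute complex_cnj_cnj)
  then have "complex_of_real ((norm (c *\<^sub>C x))\<^sup>2) = complex_of_real ((cmod c * norm x)\<^sup>2)"
    unfolding power_mult_distrib of_real_mult complex_norm_square[of c] by (simp add: cinner_self)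
  then show ?thesis
    unfolding of_real_eq_iff by (simp add: power2_eq_iff_nonneg)
qed

lemma scaleC_scaleR: "c *\<^sub>C r *\<^sub>R x = r *\<^sub>R c *\<^sub>C (x::'a::complex_inner)"
  by (simp flip: scaleC_of_real add: scaleC_scaleC mult.commute)

text \<open>Continuity of scalar multiplication lets a complex scalar pass through an infinite sum
  of blocks.\<close>

lemma bounded_linear_scaleC: "bounded_linear (\<lambda>x::'a::complex_inner. c *\<^sub>C x)"
  by (rule bounded_linear_intro[of _ "cmod c"])
    (simp_all add: scaleC_add_right scaleC_scaleR norm_scaleC mult.commute)

lemma cinner_zero_right: "cinner x (0::'a::complex_inner) = 0"
  using cinner_add_right[of x 0 0] by simp

lemma cinner_sum_right: "cinner x (\<Sum>i\<in>F. f i) = (\<Sum>i\<in>F. cinner x (f i :: 'a::complex_inner))"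
  by (induction F rule: infinite_finite_induct) (simp_all add: cinner_zero_right cinner_add_right)

text \<open>Pythagoras: the cross terms vanish, and dropping the square of \<open>norm y\<close>
  leaves the bound.\<close>

lemma norm_le_add_orthogonal:
  fixes x y :: "'a::complex_inner"
  assumes "cinner x y = 0"
  shows "norm x \<le> norm (x + y)"
proof -
  have yx: "cinner y x = 0"
    using assms cinner_commute[of y x] by simp
  have "cinner (x + y) x = cinner x x" "cinner (x + y) y = cinner y y"
    using assms yx cinner_commute[of "x + y" x] cinner_commute[of "x + y" y]
      cinner_commute[of x x] cinner_commute[of y y]
    by (simp_all add: cinner_add_right)
  then have "complex_of_real ((norm (x + y))\<^sup>2) = complex_of_real ((norm x)\<^sup>2 + (norm y)\<^sup>2)"
    by (simp only: of_real_add cinner_add_right flip: cinner_self)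
  then have "(norm (x + y))\<^sup>2 = (norm x)\<^sup>2 + (norm y)\<^sup>2"
    unfolding of_real_eq_iff .
  then show ?thesis
    by (auto intro: power2_le_imp_le)
qed

section \<open>Partial sums of a block decomposition\<close>

text \<open>For a block decomposition this is the orthogonal projection onto the closed span of the
  ranges of the \<open>P n\<close> with \<open>n\<close> in \<open>S\<close>.\<close>

definition block_sum :: "(int \<Rightarrow> 'a \<Rightarrow> 'a) \<Rightarrow> int set \<Rightarrow> 'a::complex_inner \<Rightarrow> 'a"
  where "block_sum P S = (\<lambda>x. \<Sum>\<^sub>\<infinity>n\<in>S. P n x)"

context
  fixes P :: "int \<Rightarrow> 'a::chilbert_space \<Rightarrow> 'a"
  assumes P: "block_decomposition P"
begin

lemma block_clinear: "bounded_clinear (P n)"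
  using P by (simp add: block_decomposition_def projection_def)

lemma block_bounded_linear: "bounded_linear (P n)"
  using block_clinear by (simp add: bounded_clinear_def)

lemma block_apply_block: "P m (P n x) = (if m = n then P n x else 0)"
  using P by (auto simp: block_decomposition_def projection_def fun_eq_iff)

lemma block_self_adjoint: "cinner (P n x) y = cinner x (P n y)"
  using P by (auto simp: block_decomposition_def projection_def)

lemma has_sum_blocks: "((\<lambda>n. P n x) has_sum x) UNIV"
  using P by (simp add: block_decomposition_def has_sot_sum_def)

text \<open>Unordered summability passes to subfamilies by the Cauchy criterion; completeness of the
  space enters here.\<close>

lemma has_sum_block_sum: "((\<lambda>n. P n x) has_sum block_sum P S x) S"
proof -
  have "(\<lambda>n. P n x) summable_on UNIV"
    using has_sum_blocks by (auto simp: summable_on_def)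
  then have "(\<lambda>n. P n x) summable_on S"
    by (rule summable_on_subset_aux[OF complete_UNIV isUCont_plus]) simp
  then show ?thesis
    by (simp add: block_sum_def)
qed

text \<open>Every \<open>P n\<close> with \<open>n\<close> in \<open>F\<close> kills the remainder
  \<open>x - ?G x\<close>, so by self-adjointness the remainder is orthogonal to \<open>?G x\<close>
  and Pythagoras applies. The bound is uniform in \<open>F\<close>.\<close>

lemma norm_finite_block_sum_le:
  assumes "finite F"
  shows "norm (\<Sum>n\<in>F. P n x) \<le> norm x"
proof -
  let ?G = "\<lambda>x. \<Sum>n\<in>F. P n x"
  have "P n (?G x) = P n x" if "n \<in> F" for n
    using assms that
    by (simp add: linear_sum[OF bounded_linear.linear[OF block_bounded_linear]] block_apply_block)
  then have "P n (x - ?G x) = 0" if "n \<in> F" for n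
    using that by (simp add: linear_diff[OF bounded_linear.linear[OF block_bounded_linear]])
  then have "cinner (x - ?G x) (?G x) = 0"
    by (simp add: cinner_sum_right cinner_zero_right flip: block_self_adjoint)
      (metis cinner_commute cinner_zero_right complex_cnj_zero)
  then have "cinner (?G x) (x - ?G x) = 0"
    using cinner_commute[of "?G x" "x - ?G x"] by simp
  from norm_le_add_orthogonal[OF this] show ?thesis by simp
qed

text \<open>Linearity of the blocks passes to the sum by uniqueness of limits; the constant 1 is the
  uniform bound on the finite partial sums.\<close>

lemma bounded_clinear_block_sum: "bounded_clinear (block_sum P S)"
  unfolding bounded_clinear_def
proof (intro conjI allI bounded_linear_intro[of _ 1])
  show "block_sum P S (x + y) = block_sum P S x + block_sum P S y" for x y
  proof (rule has_sum_unique[OF has_sum_block_sum])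
    show "((\<lambda>n. P n (x + y)) has_sum block_sum P S x + block_sum P S y) S"
      using has_sum_add[OF has_sum_block_sum[of x S] has_sum_block_sum[of y S]]
      by (simp add: linear_add[OF bounded_linear.linear[OF block_bounded_linear]])
  qed
  show "block_sum P S (r *\<^sub>R x) = r *\<^sub>R block_sum P S x" for r x
  proof (rule has_sum_unique[OF has_sum_block_sum])
    show "((\<lambda>n. P n (r *\<^sub>R x)) has_sum r *\<^sub>R block_sum P S x) S"
      using has_sum_bounded_linear[OF bounded_linear_scaleR_right has_sum_block_sum[of x S], of r]
      by (simp add: linear_scale[OF bounded_linear.linear[OF block_bounded_linear]])
  qed
  show "block_sum P S (c *\<^sub>C x) = c *\<^sub>C block_sum P S x" for c x
  proof (rule has_sum_unique[OF has_sum_block_sum])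
    show "((\<lambda>n. P n (c *\<^sub>C x)) has_sum c *\<^sub>C block_sum P S x) S"
      using has_sum_bounded_linear[OF bounded_linear_scaleC has_sum_block_sum[of x S], of c]
        block_clinear by (simp add: bounded_clinear_def)
  qed
  show "norm (block_sum P S x) \<le> norm x * 1" for x
  proof (rule tendsto_upperbound)
    show "((\<lambda>F. norm (\<Sum>n\<in>F. P n x)) \<longlongrightarrow> norm (block_sum P S x)) (finite_subsets_at_top S)"
      using has_sum_block_sum[of x S] unfolding has_sum_def by (rule tendsto_norm)
    show "\<forall>\<^sub>F F in finite_subsets_at_top S. norm (\<Sum>n\<in>F. P n x) \<le> norm x * 1"
      by (rule eventually_finite_subsets_at_top_weakI) (simp add: norm_finite_block_sum_le)
  qed simp
qed

end

section \<open>The shift decomposition\<close>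

context
  fixes P Q :: "int \<Rightarrow> 'a::chilbert_space \<Rightarrow> 'a" and T :: "'a \<Rightarrow> 'a" and M :: nat
  assumes P: "block_decomposition P"
    and Q: "block_decomposition Q"
    and T: "T \<in> carrier \<B>"
    and band: "block_band M P Q T"
begin

lemma band_eq_0: "\<bar>i - j\<bar> > int M \<Longrightarrow> Q i (T (P j x)) = 0"
  using band by (auto simp: block_band_def fun_eq_iff)

lemma bounded_linear_Q_T: "bounded_linear (\<lambda>x. Q n (T x))"
proof (rule bounded_linear_compose[OF block_bounded_linear[OF Q]])
  show "bounded_linear T"
    using T by (simp add: bounded_ops_def bounded_clinear_def)
qed

text \<open>Stating the column condition through \<open>m - k\<close> lets the same \<open>r\<close>
  in \<open>{0..2 * int M}\<close> label rows and columns, without reducing \<open>r + k\<close>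
  modulo \<open>2 * int M + 1\<close>.\<close>

definition residue_piece :: "int \<Rightarrow> int \<Rightarrow> 'a \<Rightarrow> 'a"
  where "residue_piece k r = block_sum Q {n. n mod (2 * int M + 1) = r} \<circ> T \<circ>
    block_sum P {m. (m - k) mod (2 * int M + 1) = r}"

lemma residue_piece_carrier: "residue_piece k r \<in> carrier \<B>"
  using T unfolding residue_piece_def
  by (simp add: bounded_ops_def bounded_clinear_comp bounded_clinear_block_sum P Q)

text \<open>\<open>T\<close> is only multiplied by a bounded operator on each side. Membership of
  the single blocks would not suffice for \<open>T_k\<close>, since an ideal need not be closed
  under strong limits.\<close>

lemma residue_piece_ideal: "residue_piece k r \<in> Idl\<^bsub>\<B>\<^esub> {T}"
proof -
  interpret ring "\<B> :: ('a \<Rightarrow> 'a) ring" by (rule ring_bounded_ops)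
  interpret J: ideal "Idl\<^bsub>\<B>\<^esub> {T}" "\<B> :: ('a \<Rightarrow> 'a) ring"
    using T by (intro genideal_ideal) simp
  have "block_sum Q S \<otimes>\<^bsub>\<B>\<^esub> T \<otimes>\<^bsub>\<B>\<^esub> block_sum P S' \<in> Idl\<^bsub>\<B>\<^esub> {T}" for S S'
    using T bounded_clinear_block_sum[OF P] bounded_clinear_block_sum[OF Q]
    by (intro J.I_r_closed J.I_l_closed genideal_self') (auto simp: bounded_ops_def)
  then show ?thesis
    by (simp add: residue_piece_def bounded_ops_def)
qed

lemma residue_piece_has_sum:
  assumes k: "\<bar>k\<bar> \<le> int M"
  shows "((\<lambda>n. Q n (T (P (n + k) x))) has_sum residue_piece k r x) {n. n mod (2 * int M + 1) = r}"
proof -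
  let ?N = "2 * int M + 1"
  let ?E = "block_sum P {m. (m - k) mod ?N = r}"
  have "Q n (T (?E x)) = Q n (T (P (n + k) x))" if n: "n mod ?N = r" for n
  proof (rule has_sum_unique)
    show "((\<lambda>m. Q n (T (P m x))) has_sum Q n (T (?E x))) {m. (m - k) mod ?N = r}"
      by (rule has_sum_bounded_linear[OF bounded_linear_Q_T has_sum_block_sum[OF P]])
    have "Q n (T (P m x)) = 0" if m: "(m - k) mod ?N = r" "m \<noteq> n + k" for m
    proof (rule band_eq_0, rule ccontr)
      assume "\<not> int M < \<bar>n - m\<bar>"
      \<comment> \<open>The two bounds add up to \<open>2 * int M\<close>, one less than the
        modulus, and the only multiple of the modulus that small is 0.\<close>
      then have "\<bar>m - k - n\<bar> < ?N" using k by linarith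
      moreover have "?N dvd m - k - n"
        by (subst mod_eq_dvd_iff[symmetric]) (simp only: m(1) n)
      ultimately have "m - k - n = 0"
        using dvd_imp_le_int[of "m - k - n" ?N] by linarith
      with m(2) show False by simp
    qed
    then show "((\<lambda>m. Q n (T (P m x))) has_sum Q n (T (P (n + k) x))) {m. (m - k) mod ?N = r}"
      \<comment> \<open>The surviving index \<open>n + k\<close> does lie in the column class,
        because \<open>n\<close> has residue \<open>r\<close>.\<close>
      using n by (intro has_sum_finite_neutralI[of "{n + k}"]) auto
  qed
  moreover have "((\<lambda>n. Q n (T (?E x))) has_sum residue_piece k r x) {n. n mod ?N = r}"
    using has_sum_block_sum[OF Q] by (simp add: residue_piece_def)
  ultimately show ?thesis
    by (subst has_sum_cong[where g = "\<lambda>n. Q n (T (?E x))"]) auto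
qed

text \<open>The residue classes partition the integers: after extension by 0, exactly one
  \<open>r\<close> contributes at each \<open>n\<close>. This also proves that the series for
  \<open>T_k\<close> converges, so the default value of \<open>infsum\<close> does not
  occur.\<close>

lemma shift_component_has_sum:
  assumes k: "\<bar>k\<bar> \<le> int M"
  shows "((\<lambda>n. Q n (T (P (n + k) x))) has_sum (\<Sum>r\<in>{0..2 * int M}. residue_piece k r x)) UNIV"
proof -
  let ?N = "2 * int M + 1" and ?f = "\<lambda>n. Q n (T (P (n + k) x))"
  have "((\<lambda>n. if n mod ?N = r then ?f n else 0) has_sum residue_piece k r x) UNIV" for r
    using residue_piece_has_sum[OF k, of x r]
    by (rule has_sum_cong_neutral[THEN iffD1, rotated -1]) auto
  then have "((\<lambda>n. \<Sum>r\<in>{0..2 * int M}. if n mod ?N = r then ?f n else 0) has_sum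
      (\<Sum>r\<in>{0..2 * int M}. residue_piece k r x)) UNIV"
    by (rule has_sum_sum_functions)
  moreover have "n mod ?N \<in> {0..2 * int M}" for n
    using pos_mod_bound[of ?N n] pos_mod_sign[of ?N n] by simp
  then have "(\<Sum>r\<in>{0..2 * int M}. if n mod ?N = r then ?f n else 0) = ?f n" for n
    by (subst sum.delta') simp_all
  ultimately show ?thesis by simp
qed

lemma shift_component_eq_finsum:
  assumes k: "\<bar>k\<bar> \<le> int M"
  shows "shift_component P Q T k = finsum \<B> (residue_piece k) {0..2 * int M}"
proof (rule ext)
  fix x
  have "shift_component P Q T k x = (\<Sum>r\<in>{0..2 * int M}. residue_piece k r x)"
    using infsumI[OF shift_component_has_sum[OF k]]
    by (simp add: shift_component_def sot_sum_def)
  then show "shift_component P Q T k x = finsum \<B> (residue_piece k) {0..2 * int M} x"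
    by (simp add: finsum_bounded_ops_apply residue_piece_carrier)
qed

lemma shift_component_ideal:
  assumes "\<bar>k\<bar> \<le> int M"
  shows "shift_component P Q T k \<in> Idl\<^bsub>\<B>\<^esub> {T}"
proof -
  interpret ring "\<B> :: ('a \<Rightarrow> 'a) ring" by (rule ring_bounded_ops)
  show ?thesis
    unfolding shift_component_eq_finsum[OF assms] using T
    by (intro ideal_finsum_closed genideal_ideal residue_piece_ideal) auto
qed

lemma shift_component_carrier:
  assumes "\<bar>k\<bar> \<le> int M"
  shows "shift_component P Q T k \<in> carrier \<B>"
proof -
  interpret ring "\<B> :: ('a \<Rightarrow> 'a) ring" by (rule ring_bounded_ops)
  show ?thesis
    unfolding shift_component_eq_finsum[OF assms]
    by (intro finsum_closed) (auto intro: residue_piece_carrier)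
qed

text \<open>At each \<open>x\<close> both sides are the sum of the same family
  \<open>Q n (T x)\<close>: on the right because the \<open>Q n\<close> sum to the identity, on the
  left by summing the series for the \<open>T_k\<close> row by row.\<close>

lemma finsum_shift_component: "finsum \<B> (shift_component P Q T) {- int M..int M} = T"
proof (rule ext)
  fix x
  have "((\<lambda>n. Q n (T x)) has_sum (\<Sum>k\<in>{- int M..int M}. shift_component P Q T k x)) UNIV"
  proof -
    have "((\<lambda>n. \<Sum>k\<in>{- int M..int M}. Q n (T (P (n + k) x))) has_sum
        (\<Sum>k\<in>{- int M..int M}. shift_component P Q T k x)) UNIV"
    proof (rule has_sum_sum_functions)
      fix k assume "k \<in> {- int M..int M}"
      then have k: "\<bar>k\<bar> \<le> int M" by auto
      show "((\<lambda>n. Q n (T (P (n + k) x))) has_sum shift_component P Q T k x) UNIV"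
        using shift_component_has_sum[OF k, of x]
        by (simp add: shift_component_eq_finsum[OF k] finsum_bounded_ops_apply
            residue_piece_carrier)
    qed
    moreover have "(\<Sum>k\<in>{- int M..int M}. Q n (T (P (n + k) x))) = Q n (T x)" for n
    proof (rule has_sum_unique)
      show "((\<lambda>m. Q n (T (P m x))) has_sum Q n (T x)) UNIV"
        by (rule has_sum_bounded_linear[OF bounded_linear_Q_T has_sum_blocks[OF P]])
      show "((\<lambda>m. Q n (T (P m x))) has_sum (\<Sum>k\<in>{- int M..int M}. Q n (T (P (n + k) x)))) UNIV"
      \<comment> \<open>In row \<open>n\<close> the band condition leaves only the columns
        \<open>m = n + k\<close> with \<open>k\<close> between \<open>- int M\<close> and
        \<open>int M\<close>.\<close>
      proof (rule has_sum_finite_neutralI[of "{n - int M..n + int M}"])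
        show "(\<Sum>k\<in>{- int M..int M}. Q n (T (P (n + k) x))) =
            (\<Sum>m\<in>{n - int M..n + int M}. Q n (T (P m x)))"
          by (rule sum.reindex_bij_witness[of _ "\<lambda>m. m - n" "\<lambda>k. n + k"]) auto
      qed (auto intro!: band_eq_0)
    qed
    ultimately show ?thesis by simp
  qed
  then have "(\<Sum>k\<in>{- int M..int M}. shift_component P Q T k x) = T x"
    by (rule has_sum_unique[OF _ has_sum_blocks[OF Q]])
  then show "finsum \<B> (shift_component P Q T) {- int M..int M} x = T x"
    by (subst finsum_bounded_ops_apply) (auto intro: shift_component_carrier)
qed

end

theorem theorem4:
  fixes P Q :: "int \<Rightarrow> 'a::chilbert_space \<Rightarrow> 'a"
    and T :: "'a \<Rightarrow> 'a"
    and M :: nat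
  assumes "block_decomposition P"
    and "block_decomposition Q"
    and "T \<in> carrier \<B>"
    and "block_band M P Q T"
  shows "Idl\<^bsub>\<B>\<^esub> {T} =
    ideal_sum \<B> {- int M..int M} (\<lambda>k. Idl\<^bsub>\<B>\<^esub> {shift_component P Q T k})"
proof
  interpret ring "\<B> :: ('a \<Rightarrow> 'a) ring" by (rule ring_bounded_ops)
  let ?K = "{- int M..int M}" and ?T = "shift_component P Q T"
  let ?J = "ideal_sum \<B> ?K (\<lambda>k. Idl\<^bsub>\<B>\<^esub> {?T k})"
  have carr: "?T k \<in> carrier \<B>" and in_T: "?T k \<in> Idl\<^bsub>\<B>\<^esub> {T}" if "k \<in> ?K" for k
    using that shift_component_carrier[OF assms, of k] shift_component_ideal[OF assms, of k]
    by auto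
  have "ideal ?J \<B>"
    using carr by (intro ideal_ideal_sum genideal_ideal) auto
  \<comment> \<open>Taking \<open>T_k\<close> itself from the ideal it generates shows that their
    sum, which is \<open>T\<close>, lies in \<open>?J\<close>.\<close>
  moreover have "finsum \<B> ?T ?K \<in> ?J"
    using carr by (intro ideal_sumI genideal_self')
  ultimately show "Idl\<^bsub>\<B>\<^esub> {T} \<subseteq> ?J"
    unfolding finsum_shift_component[OF assms] by (intro genideal_minimal) auto
  have T: "ideal (Idl\<^bsub>\<B>\<^esub> {T}) \<B>"
    using assms(3) by (intro genideal_ideal) auto
  then have "Idl\<^bsub>\<B>\<^esub> {?T k} \<subseteq> Idl\<^bsub>\<B>\<^esub> {T}" if "k \<in> ?K" for k
    using in_T[OF that] by (intro genideal_minimal) auto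
  then show "?J \<subseteq> Idl\<^bsub>\<B>\<^esub> {T}"
    unfolding ideal_sum_def by (blast intro: ideal_finsum_closed[OF T finite_atLeastAtMost_int])
qed

end
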